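(* Let $\mathcal{E}=\{\epsilon_p(i),\ i\in[p],\ p\in\mathbb{N}\}$ be a (possibly dependent) relatively stable Gaussian triangular array with standard Normal marginals, and let $M_p:=\max_{i\in[p]}\epsilon_p(i)$. Let $a_p>0$ and $b_p\in\mathbb{R}$ be sequences for which the maximum $M_p^*$ of $p$ independent standard Normal random variables satisfies $a_p(M_p^*-b_p)\stackrel{d}{\to}\text{Gumbel}$, i.e. $\Phi(a_p^{-1}x+b_p)^p\to\exp\{-e^{-x}\}$ for all $x\in\mathbb{R}$. Suppose that, with these same constants, $$\zeta_p:=a_p(M_p-b_p)\stackrel{d}{\longrightarrow}\zeta,\quad\text{as }p\to\infty,$$ for some non-degenerate random variable $\zeta$ with $\mathbb{P}(\zeta<x)>0$ and $\mathbb{P}(\zeta>x)>0$ for all $x\in\mathbb{R}$. Let $$\delta_p^{opt}:=\frac{1}{a_p^2}+\left|\frac{b_p}{a_p}-1\right|,$$ and let $\delta_p>0$ be a sequence with $\delta_p\to 0$. Consider the relation $$\mathbb{P}\left(\left|\frac{M_p}{a_p}-1\right|>\delta_p\right)\to 0,\quad p\to\infty.\qquad(\ast)$$ (a) If $\limsup_{p\to\infty}a_p|b_p-a_p|<\infty$, then $(\ast)$ holds if and only if $\delta_p\gg\delta_p^{opt}$. (b) If $\limsup_{p\to\infty}a_p|b_p-a_p|=\infty$, then $(\ast)$ holds if and only if $$\liminf_{p\to\infty}\left[\frac{\delta_p}{\delta_p^{opt}}-1\right]\bigl(1+a_p|b_p-a_p|\bigr)=\infty.$$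
   Context: $[p]=\{1,\dots,p\}$; $\Phi$ is the standard Normal cumulative distribution function. A Gaussian triangular array with standard Normal marginals is a family $\{\epsilon_p(i),\ i\in[p],\ p\in\mathbb{N}\}$ such that, for each $p$, $(\epsilon_p(1),\dots,\epsilon_p(p))$ is jointly Gaussian (with arbitrary dependence) and each $\epsilon_p(i)\sim N(0,1)$. Such an array is relatively stable if $\frac{1}{u_p}\max_{i\in[p]}\epsilon_p(i)\to 1$ in probability as $p\to\infty$, where $u_p=\Phi^{-1}(1-1/p)$. For two positive sequences $\alpha_p,\beta_p$ converging to $0$, $\alpha_p\gg\beta_p$ means $\beta_p/\alpha_p\to 0$ as $p\to\infty$. *)

theory Defs
  imports "HOL-Probability.Probability"
begin

text \<open>Degenerate (constant) laws count as Gaussian, so that singular covariance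
  matrices are allowed in \<open>jointly_gaussian\<close>.\<close>

definition gaussian_rv :: "'a measure \<Rightarrow> ('a \<Rightarrow> real) \<Rightarrow> bool" where
  "gaussian_rv M X \<longleftrightarrow>
     (\<exists>\<mu> \<sigma>. \<sigma> > 0 \<and> distributed M lborel X (normal_density \<mu> \<sigma>)) \<or>
     (\<exists>\<mu>. X \<in> borel_measurable M \<and> distr M borel X = return borel \<mu>)"

definition jointly_gaussian :: "'a measure \<Rightarrow> 'i set \<Rightarrow> ('i \<Rightarrow> 'a \<Rightarrow> real) \<Rightarrow> bool" where
  "jointly_gaussian M I X \<longleftrightarrow>
     (\<forall>i\<in>I. X i \<in> borel_measurable M) \<and>
     (\<forall>t :: 'i \<Rightarrow> real. gaussian_rv M (\<lambda>\<omega>. \<Sum>i\<in>I. t i * X i \<omega>))"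

text \<open>Row \<open>p\<close> of the array \<open>\<epsilon>\<close> consists of \<open>\<epsilon> p i\<close> for \<open>i \<in> {1..p}\<close>, \<open>p \<ge> 1\<close>;
  nothing is assumed about values at other indices.\<close>

definition std_gaussian_array :: "'a measure \<Rightarrow> (nat \<Rightarrow> nat \<Rightarrow> 'a \<Rightarrow> real) \<Rightarrow> bool" where
  "std_gaussian_array M \<epsilon> \<longleftrightarrow>
     (\<forall>p\<ge>1. jointly_gaussian M {1..p} (\<epsilon> p) \<and>
        (\<forall>i\<in>{1..p}. distributed M lborel (\<epsilon> p i) std_normal_density))"

definition row_max :: "(nat \<Rightarrow> nat \<Rightarrow> 'a \<Rightarrow> real) \<Rightarrow> nat \<Rightarrow> 'a \<Rightarrow> real" where
  "row_max \<epsilon> p \<omega> = Max ((\<lambda>i. \<epsilon> p i \<omega>) ` {1..p})"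

definition std_normal_cdf :: "real \<Rightarrow> real" where
  "std_normal_cdf = cdf std_normal_distribution"

text \<open>The inverse is meaningful on \<open>{0<..<1}\<close>, i.e. for \<open>p \<ge> 2\<close>.\<close>

definition normal_quantile_seq :: "nat \<Rightarrow> real" where
  "normal_quantile_seq p = inv std_normal_cdf (1 - 1 / real p)"

definition converges_in_prob :: "'a measure \<Rightarrow> (nat \<Rightarrow> 'a \<Rightarrow> real) \<Rightarrow> real \<Rightarrow> bool" where
  "converges_in_prob M X c \<longleftrightarrow>
     (\<forall>e>0. (\<lambda>p. \<P>(\<omega> in M. \<bar>X p \<omega> - c\<bar> > e)) \<longlonglongrightarrow> 0)"

definition relatively_stable :: "'a measure \<Rightarrow> (nat \<Rightarrow> nat \<Rightarrow> 'a \<Rightarrow> real) \<Rightarrow> bool" where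
  "relatively_stable M \<epsilon> \<longleftrightarrow>
     converges_in_prob M (\<lambda>p \<omega>. row_max \<epsilon> p \<omega> / normal_quantile_seq p) 1"

definition delta_opt :: "(nat \<Rightarrow> real) \<Rightarrow> (nat \<Rightarrow> real) \<Rightarrow> nat \<Rightarrow> real" where
  "delta_opt a b p = 1 / (a p)\<^sup>2 + \<bar>b p / a p - 1\<bar>"

text \<open>\<open>\<alpha> \<ggreater> \<beta>\<close>, for positive sequences converging to \<open>0\<close>.\<close>

definition dominates :: "(nat \<Rightarrow> real) \<Rightarrow> (nat \<Rightarrow> real) \<Rightarrow> bool" where
  "dominates \<alpha> \<beta> \<longleftrightarrow> (\<lambda>p. \<beta> p / \<alpha> p) \<longlonglongrightarrow> 0"

end

theory Submission
  imports Defs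
begin

text \<open>Put \<open>c\<^sub>p = a\<^sub>p (b\<^sub>p - a\<^sub>p)\<close> and \<open>d\<^sub>p = a\<^sub>p\<^sup>2 \<delta>\<^sub>p\<close>.  Multiplying the
  deviation of \<open>M\<^sub>p / a\<^sub>p\<close> from \<open>1\<close> by \<open>a\<^sub>p\<^sup>2\<close> turns it into the translate \<open>\<zeta>\<^sub>p + c\<^sub>p\<close> of the
  normalised maximum, so the relation in question says
  \<open>P(\<bar>\<zeta>\<^sub>p + c\<^sub>p\<bar> > d\<^sub>p) \<rightarrow> 0\<close>.

  The sequence \<open>\<zeta>\<^sub>p\<close> converges in law to a random variable whose distribution charges every
  half-line.  Convergence in law gives tightness, hence a tail probability
  \<open>P(\<zeta>\<^sub>p > t\<^sub>p)\<close> vanishes when \<open>t\<^sub>p \<rightarrow> \<infinity>\<close>.  Conversely, if \<open>t\<^sub>p\<close> stays below some level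
  infinitely often, then along those indices the tail probability is bounded below by the
  positive mass that the limit puts above this level.  With the mirror image for the lower tail
  (\<open>upper_tail_vanishes_iff\<close>, \<open>lower_tail_vanishes_iff\<close>) this shows that the relation is
  equivalent to \<open>d\<^sub>p - \<bar>c\<^sub>p\<bar> \<rightarrow> \<infinity>\<close> (\<open>translate_deviation_vanishes_iff\<close>).

  Both criteria are rewritings of this condition, because
  \<open>a\<^sub>p\<^sup>2 \<delta>\<^sub>p\<^sup>o\<^sup>p\<^sup>t = 1 + \<bar>c\<^sub>p\<bar>\<close>.  The product in (b) equals
  \<open>d\<^sub>p - \<bar>c\<^sub>p\<bar> - 1\<close>.  In (a), where \<open>c\<^sub>p\<close> is bounded, the condition reads \<open>d\<^sub>p \<rightarrow> \<infinity>\<close>, which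
  is \<open>(1 + \<bar>c\<^sub>p\<bar>) / d\<^sub>p \<rightarrow> 0\<close>.\<close>

section \<open>Vanishing tails under convergence in law\<close>

lemma (in finite_borel_measure) exists_isCont_cdf_between:
  fixes x y :: real
  assumes "x < y"
  shows "\<exists>z. x < z \<and> z < y \<and> isCont (cdf M) z"
proof (rule ccontr)
  assume "\<not> ?thesis"
  then have "{x<..<y} \<subseteq> {z. \<not> isCont (cdf M) z}" by auto
  moreover have "countable {z. \<not> isCont (cdf M) z}"
    by (rule mono_ctble_discont) (simp add: cdf_nondecreasing mono_def)
  ultimately have "countable {x<..<y}" by (rule countable_subset)
  then show False using uncountable_open_interval[of x y] assms by simp
qed

lemma (in real_distribution) measure_greaterThan_eq: "measure M {x<..} = 1 - cdf M x"
proof -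
  have "{x<..} = space M - {..x}" by auto
  then show ?thesis using prob_compl[of "{..x}"] by (simp add: cdf_def)
qed

text \<open>Continuity points of the limiting distribution function transfer mass between \<open>\<mu> n\<close> and
  \<open>\<nu>\<close>.  One far to the right makes the tail of \<open>\<nu>\<close> small, which gives sufficiency.  One to the
  right of a level that \<open>t\<close> fails to exceed infinitely often still leaves positive mass above
  it, which gives necessity.\<close>

lemma upper_tail_vanishes_iff:
  fixes t :: "nat \<Rightarrow> real"
  assumes \<mu>: "\<forall>\<^sub>F n in sequentially. real_distribution (\<mu> n)"
    and \<nu>: "real_distribution \<nu>"
    and conv: "weak_conv_m \<mu> \<nu>"
    and pos: "\<And>x. measure \<nu> {x<..} > 0"
  shows "(\<lambda>n. measure (\<mu> n) {t n<..}) \<longlonglongrightarrow> 0 \<longleftrightarrow> filterlim t at_top sequentially"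
proof
  interpret \<nu>: real_distribution \<nu> by fact
  have lim: "(\<lambda>n. cdf (\<mu> n) x) \<longlonglongrightarrow> cdf \<nu> x" if "isCont (cdf \<nu>) x" for x
    using conv that by (simp add: weak_conv_m_def weak_conv_def)
  { assume tail: "(\<lambda>n. measure (\<mu> n) {t n<..}) \<longlonglongrightarrow> 0"
    show "filterlim t at_top sequentially"
      unfolding filterlim_at_top
    proof
      fix K :: real
      obtain z where z: "K < z" "isCont (cdf \<nu>) z"
        using \<nu>.exists_isCont_cdf_between[of K "K + 1"] by auto
      have "cdf \<nu> z < 1" using pos[of z] by (simp add: \<nu>.measure_greaterThan_eq)
      then obtain e where e: "0 < e" "cdf \<nu> z < 1 - e"
        by (metis diff_gt_0_iff_gt dense less_diff_eq add.commute)
      have "\<forall>\<^sub>F n in sequentially. cdf (\<mu> n) z < 1 - e"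
        using lim[OF z(2)] e(2) by (rule order_tendstoD)
      moreover have "\<forall>\<^sub>F n in sequentially. measure (\<mu> n) {t n<..} < e"
        using tail e(1) by (rule order_tendstoD)
      ultimately show "\<forall>\<^sub>F n in sequentially. K \<le> t n"
        using \<mu>
      proof eventually_elim
        case (elim n)
        interpret real_distribution "\<mu> n" by fact
        from elim(1,2) have "cdf (\<mu> n) z < cdf (\<mu> n) (t n)"
          by (simp add: measure_greaterThan_eq)
        then have "z < t n" using cdf_nondecreasing[of "t n" z] by linarith
        with z(1) show ?case by linarith
      qed
    qed }
  { assume t: "filterlim t at_top sequentially"
    show "(\<lambda>n. measure (\<mu> n) {t n<..}) \<longlonglongrightarrow> 0"
    proof (rule order_tendstoI)
      fix e :: real assume "e > 0"
      have "\<forall>\<^sub>F x in at_top. cdf \<nu> x > 1 - e"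
        using \<nu>.cdf_lim_at_top_prob \<open>e > 0\<close> by (intro order_tendstoD) auto
      then obtain K where K: "\<And>x. x \<ge> K \<Longrightarrow> cdf \<nu> x > 1 - e"
        by (auto simp: eventually_at_top_linorder)
      obtain z where z: "K < z" "isCont (cdf \<nu>) z"
        using \<nu>.exists_isCont_cdf_between[of K "K + 1"] by auto
      have "\<forall>\<^sub>F n in sequentially. cdf (\<mu> n) z > 1 - e"
        using lim[OF z(2)] K[of z] z(1) by (intro order_tendstoD) auto
      moreover have "\<forall>\<^sub>F n in sequentially. z \<le> t n"
        using t by (simp add: filterlim_at_top)
      ultimately show "\<forall>\<^sub>F n in sequentially. measure (\<mu> n) {t n<..} < e"
        using \<mu>
      proof eventually_elim
        case (elim n)
        interpret real_distribution "\<mu> n" by fact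
        show ?case
          using elim(1) cdf_nondecreasing[OF elim(2)] by (simp add: measure_greaterThan_eq)
      qed
    qed (auto intro!: always_eventually simp: less_le_trans[OF _ measure_nonneg]) }
qed

text \<open>The mirror image of the upper tail.  Reflection turns a right-continuous distribution
  function into a left-continuous one, so transporting convergence of distribution functions
  along it would cost more than repeating the argument.\<close>

lemma lower_tail_vanishes_iff:
  fixes t :: "nat \<Rightarrow> real"
  assumes \<mu>: "\<forall>\<^sub>F n in sequentially. real_distribution (\<mu> n)"
    and \<nu>: "real_distribution \<nu>"
    and conv: "weak_conv_m \<mu> \<nu>"
    and pos: "\<And>x. measure \<nu> {..<x} > 0"
  shows "(\<lambda>n. measure (\<mu> n) {..<t n}) \<longlonglongrightarrow> 0 \<longleftrightarrow> filterlim t at_bot sequentially"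
proof
  interpret \<nu>: real_distribution \<nu> by fact
  have lim: "(\<lambda>n. cdf (\<mu> n) x) \<longlonglongrightarrow> cdf \<nu> x" if "isCont (cdf \<nu>) x" for x
    using conv that by (simp add: weak_conv_m_def weak_conv_def)
  { assume tail: "(\<lambda>n. measure (\<mu> n) {..<t n}) \<longlonglongrightarrow> 0"
    show "filterlim t at_bot sequentially"
      unfolding filterlim_at_bot
    proof
      fix K :: real
      obtain z where z: "z < K" "isCont (cdf \<nu>) z"
        using \<nu>.exists_isCont_cdf_between[of "K - 1" K] by auto
      have "measure \<nu> {..<z} \<le> cdf \<nu> z"
        unfolding cdf_def by (intro \<nu>.finite_measure_mono) auto
      with pos[of z] have "0 < cdf \<nu> z" by linarith
      then obtain e where e: "0 < e" "e < cdf \<nu> z" using dense by blast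
      have "\<forall>\<^sub>F n in sequentially. e < cdf (\<mu> n) z"
        using lim[OF z(2)] e(2) by (rule order_tendstoD)
      moreover have "\<forall>\<^sub>F n in sequentially. measure (\<mu> n) {..<t n} < e"
        using tail e(1) by (rule order_tendstoD)
      ultimately show "\<forall>\<^sub>F n in sequentially. t n \<le> K"
        using \<mu>
      proof eventually_elim
        case (elim n)
        interpret real_distribution "\<mu> n" by fact
        have "cdf (\<mu> n) z \<le> measure (\<mu> n) {..<t n}" if "z < t n"
          unfolding cdf_def using that by (intro finite_measure_mono) auto
        with elim(1,2) have "t n \<le> z" by fastforce
        with z(1) show ?case by linarith
      qed
    qed }
  { assume t: "filterlim t at_bot sequentially"
    show "(\<lambda>n. measure (\<mu> n) {..<t n}) \<longlonglongrightarrow> 0"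
    proof (rule order_tendstoI)
      fix e :: real assume "e > 0"
      have "\<forall>\<^sub>F x in at_bot. cdf \<nu> x < e"
        using \<nu>.cdf_lim_at_bot \<open>e > 0\<close> by (intro order_tendstoD) auto
      then obtain K where K: "\<And>x. x \<le> K \<Longrightarrow> cdf \<nu> x < e"
        by (auto simp: eventually_at_bot_linorder)
      obtain z where z: "z < K" "isCont (cdf \<nu>) z"
        using \<nu>.exists_isCont_cdf_between[of "K - 1" K] by auto
      have "\<forall>\<^sub>F n in sequentially. cdf (\<mu> n) z < e"
        using lim[OF z(2)] K[of z] z(1) by (intro order_tendstoD) auto
      moreover have "\<forall>\<^sub>F n in sequentially. t n \<le> z"
        using t by (simp add: filterlim_at_bot)
      ultimately show "\<forall>\<^sub>F n in sequentially. measure (\<mu> n) {..<t n} < e"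
        using \<mu>
      proof eventually_elim
        case (elim n)
        interpret real_distribution "\<mu> n" by fact
        have "measure (\<mu> n) {..<t n} \<le> cdf (\<mu> n) z"
          unfolding cdf_def using elim(2) by (intro finite_measure_mono) auto
        with elim(1) show ?case by linarith
      qed
    qed (auto intro!: always_eventually simp: less_le_trans[OF _ measure_nonneg]) }
qed

text \<open>The event is the union of an upper tail at level \<open>d - c\<close> and a lower tail at level
  \<open>- d - c\<close>, so its probability lies between the larger of the two tail probabilities and their
  sum; both levels escape to infinity precisely when \<open>d - \<bar>c\<bar>\<close> does.\<close>

lemma translate_deviation_vanishes_iff:
  fixes c d :: "nat \<Rightarrow> real"
  assumes \<mu>: "\<forall>\<^sub>F n in sequentially. real_distribution (\<mu> n)"
    and \<nu>: "real_distribution \<nu>"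
    and conv: "weak_conv_m \<mu> \<nu>"
    and upper: "\<And>x. measure \<nu> {x<..} > 0"
    and lower: "\<And>x. measure \<nu> {..<x} > 0"
  shows "(\<lambda>n. measure (\<mu> n) {x. \<bar>x + c n\<bar> > d n}) \<longlonglongrightarrow> 0 \<longleftrightarrow>
    filterlim (\<lambda>n. d n - \<bar>c n\<bar>) at_top sequentially"
proof -
  let ?D = "\<lambda>n. measure (\<mu> n) {x. \<bar>x + c n\<bar> > d n}"
  let ?U = "\<lambda>n. measure (\<mu> n) {d n - c n<..}"
  let ?L = "\<lambda>n. measure (\<mu> n) {..<- d n - c n}"
  have split: "{x. \<bar>x + c n\<bar> > d n} = {d n - c n<..} \<union> {..<- d n - c n}" for n
    by auto
  have bounds: "\<forall>\<^sub>F n in sequentially. ?U n \<le> ?D n \<and> ?L n \<le> ?D n \<and> ?D n \<le> ?U n + ?L n"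
    using \<mu>
  proof eventually_elim
    case (elim n)
    interpret real_distribution "\<mu> n" by fact
    show ?case
      unfolding split by (auto intro!: finite_measure_mono measure_Un_le)
  qed
  have "?D \<longlonglongrightarrow> 0 \<longleftrightarrow> ?U \<longlonglongrightarrow> 0 \<and> ?L \<longlonglongrightarrow> 0"
  proof (intro iffI conjI)
    assume D: "?D \<longlonglongrightarrow> 0"
    show "?U \<longlonglongrightarrow> 0" using bounds
      by (intro tendsto_sandwich[OF _ _ tendsto_const D]) (auto elim: eventually_mono)
    show "?L \<longlonglongrightarrow> 0" using bounds
      by (intro tendsto_sandwich[OF _ _ tendsto_const D]) (auto elim: eventually_mono)
  next
    assume "?U \<longlonglongrightarrow> 0 \<and> ?L \<longlonglongrightarrow> 0"
    then have sum: "(\<lambda>n. ?U n + ?L n) \<longlonglongrightarrow> 0" by (intro tendsto_add_zero) auto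
    show "?D \<longlonglongrightarrow> 0" using bounds
      by (intro tendsto_sandwich[OF _ _ tendsto_const sum]) (auto elim: eventually_mono)
  qed
  also have "?U \<longlonglongrightarrow> 0 \<longleftrightarrow> filterlim (\<lambda>n. d n - c n) at_top sequentially"
    by (rule upper_tail_vanishes_iff[OF \<mu> \<nu> conv upper])
  also have "?L \<longlonglongrightarrow> 0 \<longleftrightarrow> filterlim (\<lambda>n. - d n - c n) at_bot sequentially"
    by (rule lower_tail_vanishes_iff[OF \<mu> \<nu> conv lower])
  also have "\<dots> \<longleftrightarrow> filterlim (\<lambda>n. d n + c n) at_top sequentially"
    by (simp add: filterlim_uminus_at_top)
  also have "filterlim (\<lambda>n. d n - c n) at_top sequentially \<and>
      filterlim (\<lambda>n. d n + c n) at_top sequentially \<longleftrightarrow>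
    filterlim (\<lambda>n. d n - \<bar>c n\<bar>) at_top sequentially"
  proof -
    have "K \<le> d n - \<bar>c n\<bar> \<longleftrightarrow> K \<le> d n - c n \<and> K \<le> d n + c n" for K n
      by linarith
    then show ?thesis
      by (simp add: filterlim_at_top eventually_conj_iff all_conj_distrib)
  qed
  finally show ?thesis .
qed

section \<open>The normalised row maximum and its optimal rate\<close>

lemma borel_measurable_row_max:
  assumes "std_gaussian_array M \<epsilon>" "p \<ge> 1"
  shows "row_max \<epsilon> p \<in> borel_measurable M"
proof -
  have "\<epsilon> p i \<in> borel_measurable M" if "i \<in> {1..p}" for i
    using assms that by (auto simp: std_gaussian_array_def jointly_gaussian_def)
  then have "(\<lambda>\<omega>. Max ((\<lambda>i. \<epsilon> p i \<omega>) ` {1..p})) \<in> borel_measurable M"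
    using borel_measurable_Max[of "{1..p}" "\<epsilon> p" M] by simp
  then show ?thesis by (simp add: row_max_def[abs_def])
qed

lemma deviation_iff_translate_deviation:
  fixes a b m \<delta> :: real
  assumes "a > 0"
  shows "\<bar>m / a - 1\<bar> > \<delta> \<longleftrightarrow> \<bar>a * (m - b) + a * (b - a)\<bar> > a\<^sup>2 * \<delta>"
proof -
  have "a * (m - b) + a * (b - a) = a\<^sup>2 * (m / a - 1)"
    using assms by (simp add: field_simps power2_eq_square)
  then show ?thesis using assms by (simp add: abs_mult)
qed

text \<open>On the scale \<open>a\<^sup>2\<close> the optimal rate is the modulus of the translation \<open>a (b - a)\<close>
  plus the unit of fluctuation of the normalised maximum.\<close>

lemma square_mult_delta_opt:
  assumes "a p > 0"
  shows "(a p)\<^sup>2 * delta_opt a b p = 1 + a p * \<bar>b p - a p\<bar>"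
proof -
  have "b p / a p - 1 = (b p - a p) / a p"
    using assms by (simp add: field_simps)
  then have "\<bar>b p / a p - 1\<bar> = \<bar>b p - a p\<bar> / a p"
    using assms by simp
  then show ?thesis
    using assms by (simp add: delta_opt_def field_simps power2_eq_square)
qed

lemma liminf_ereal_eq_PInfty_iff:
  fixes f :: "nat \<Rightarrow> real"
  shows "liminf (\<lambda>n. ereal (f n)) = \<infinity> \<longleftrightarrow> filterlim f at_top sequentially"
  using Liminf_PInfty[of sequentially "\<lambda>n. ereal (f n)"] tendsto_PInfty_eq_at_top[of f]
  by simp

theorem proposition3p1:
  fixes M :: "'a measure" and N :: "'b measure"
    and \<epsilon> :: "nat \<Rightarrow> nat \<Rightarrow> 'a \<Rightarrow> real" and \<zeta> :: "'b \<Rightarrow> real"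
    and a b \<delta> :: "nat \<Rightarrow> real"
  assumes "prob_space M"
    and "std_gaussian_array M \<epsilon>"
    and "relatively_stable M \<epsilon>"
    and "\<And>p. p \<ge> 1 \<Longrightarrow> a p > 0"
    and "\<And>x. (\<lambda>p. std_normal_cdf (inverse (a p) * x + b p) ^ p) \<longlonglongrightarrow> exp (- exp (- x))"
    and "prob_space N"
    and "\<zeta> \<in> borel_measurable N"
    and "\<not> (\<exists>c. AE \<omega> in N. \<zeta> \<omega> = c)"
    and "\<And>x. \<P>(\<omega> in N. \<zeta> \<omega> < x) > 0"
    and "\<And>x. \<P>(\<omega> in N. \<zeta> \<omega> > x) > 0"
    and "weak_conv_m (\<lambda>p. distr M borel (\<lambda>\<omega>. a p * (row_max \<epsilon> p \<omega> - b p))) (distr N borel \<zeta>)"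
    and "\<And>p. p \<ge> 1 \<Longrightarrow> \<delta> p > 0"
    and "\<delta> \<longlonglongrightarrow> 0"
  shows "(limsup (\<lambda>p. ereal (a p * \<bar>b p - a p\<bar>)) < \<infinity> \<longrightarrow>
            (((\<lambda>p. \<P>(\<omega> in M. \<bar>row_max \<epsilon> p \<omega> / a p - 1\<bar> > \<delta> p)) \<longlonglongrightarrow> 0) \<longleftrightarrow>
             dominates \<delta> (delta_opt a b))) \<and>
         (limsup (\<lambda>p. ereal (a p * \<bar>b p - a p\<bar>)) = \<infinity> \<longrightarrow>
            (((\<lambda>p. \<P>(\<omega> in M. \<bar>row_max \<epsilon> p \<omega> / a p - 1\<bar> > \<delta> p)) \<longlonglongrightarrow> 0) \<longleftrightarrow>
             liminf (\<lambda>p. ereal ((\<delta> p / delta_opt a b p - 1) * (1 + a p * \<bar>b p - a p\<bar>))) = \<infinity>))"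
proof -
  (* Row 0 is empty and its constants are arbitrary, so whatever needs measurability or
     positivity is stated eventually. *)
  interpret prob_space M by fact
  interpret N: prob_space N by fact
  note a_pos = assms(4) and \<delta>_pos = assms(12)
  define c where "c p = a p * (b p - a p)" for p
  define d where "d p = (a p)\<^sup>2 * \<delta> p" for p
  define X where "X p \<omega> = a p * (row_max \<epsilon> p \<omega> - b p)" for p \<omega>
  have pos: "\<forall>\<^sub>F p in sequentially. a p > 0 \<and> \<delta> p > 0"
    using a_pos \<delta>_pos by (auto intro!: eventually_sequentiallyI[of 1])
  have abs_c: "\<forall>\<^sub>F p in sequentially. a p * \<bar>b p - a p\<bar> = \<bar>c p\<bar>"
    using pos by eventually_elim (simp add: c_def abs_mult)
  have X: "X p \<in> borel_measurable M" if "p \<ge> 1" for p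
    using borel_measurable_row_max[OF assms(2) that] by (simp add: X_def[abs_def])
  have "\<forall>\<^sub>F p in sequentially.
    \<P>(\<omega> in M. \<bar>row_max \<epsilon> p \<omega> / a p - 1\<bar> > \<delta> p) =
    measure (distr M borel (X p)) {x. \<bar>x + c p\<bar> > d p}"
  proof (rule eventually_sequentiallyI)
    fix p :: nat assume p: "p \<ge> 1"
    have "measure (distr M borel (X p)) {x. \<bar>x + c p\<bar> > d p} =
        \<P>(\<omega> in M. \<bar>X p \<omega> + c p\<bar> > d p)"
      using X[OF p] by (subst measure_distr) (auto intro!: arg_cong[where f = "measure M"])
    then show "\<P>(\<omega> in M. \<bar>row_max \<epsilon> p \<omega> / a p - 1\<bar> > \<delta> p) =
        measure (distr M borel (X p)) {x. \<bar>x + c p\<bar> > d p}"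
      using deviation_iff_translate_deviation[OF a_pos[OF p], of "\<delta> p" _ "b p"]
      by (simp add: X_def c_def d_def)
  qed
  then have "(\<lambda>p. \<P>(\<omega> in M. \<bar>row_max \<epsilon> p \<omega> / a p - 1\<bar> > \<delta> p)) \<longlonglongrightarrow> 0 \<longleftrightarrow>
    (\<lambda>p. measure (distr M borel (X p)) {x. \<bar>x + c p\<bar> > d p}) \<longlonglongrightarrow> 0"
    by (rule tendsto_cong)
  also have "\<dots> \<longleftrightarrow> filterlim (\<lambda>p. d p - \<bar>c p\<bar>) at_top sequentially"
  proof (rule translate_deviation_vanishes_iff)
    show "\<forall>\<^sub>F p in sequentially. real_distribution (distr M borel (X p))"
      using X by (auto intro!: eventually_sequentiallyI[of 1])
    show "real_distribution (distr N borel \<zeta>)"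
      using assms(7) by (rule N.real_distribution_distr)
    show "weak_conv_m (\<lambda>p. distr M borel (X p)) (distr N borel \<zeta>)"
      using assms(11) by (simp add: X_def[abs_def])
    show "measure (distr N borel \<zeta>) {x<..} > 0" for x
      using assms(7) assms(10)[of x]
      by (simp add: measure_distr vimage_def Int_def conj_commute)
    show "measure (distr N borel \<zeta>) {..<x} > 0" for x
      using assms(7) assms(9)[of x]
      by (simp add: measure_distr vimage_def Int_def conj_commute)
  qed
  finally have main: "(\<lambda>p. \<P>(\<omega> in M. \<bar>row_max \<epsilon> p \<omega> / a p - 1\<bar> > \<delta> p)) \<longlonglongrightarrow> 0 \<longleftrightarrow>
    filterlim (\<lambda>p. d p - \<bar>c p\<bar>) at_top sequentially" .
  show ?thesis
  proof (intro conjI impI)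
    assume "limsup (\<lambda>p. ereal (a p * \<bar>b p - a p\<bar>)) < \<infinity>"
    then obtain B where "limsup (\<lambda>p. ereal (a p * \<bar>b p - a p\<bar>)) < ereal B"
      using less_PInf_Ex_of_nat by (metis ereal_dense2)
    then have "\<forall>\<^sub>F p in sequentially. a p * \<bar>b p - a p\<bar> < B"
      using Limsup_lessD by fastforce
    with abs_c have bound: "\<forall>\<^sub>F p in sequentially. \<bar>c p\<bar> \<le> B"
      by eventually_elim simp
    have ratio: "\<forall>\<^sub>F p in sequentially. delta_opt a b p / \<delta> p = (1 + \<bar>c p\<bar>) / d p \<and> d p > 0"
      using pos abs_c
    proof eventually_elim
      case (elim p)
      then have "(1 + \<bar>c p\<bar>) / d p = ((a p)\<^sup>2 * delta_opt a b p) / ((a p)\<^sup>2 * \<delta> p)"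
        by (simp add: square_mult_delta_opt d_def)
      with elim show ?case by (simp add: d_def)
    qed
    have "filterlim (\<lambda>p. d p - \<bar>c p\<bar>) at_top sequentially \<longleftrightarrow> filterlim d at_top sequentially"
    proof
      assume "filterlim (\<lambda>p. d p - \<bar>c p\<bar>) at_top sequentially"
      then show "filterlim d at_top sequentially"
        by (rule filterlim_at_top_mono) auto
    next
      assume "filterlim d at_top sequentially"
      then have "filterlim (\<lambda>p. - B + d p) at_top sequentially"
        by (intro filterlim_tendsto_add_at_top[OF tendsto_const])
      then show "filterlim (\<lambda>p. d p - \<bar>c p\<bar>) at_top sequentially"
        by (rule filterlim_at_top_mono) (use bound in \<open>auto elim: eventually_mono\<close>)
    qed
    also have "\<dots> \<longleftrightarrow> (\<lambda>p. (1 + \<bar>c p\<bar>) / d p) \<longlonglongrightarrow> 0"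
    proof
      assume d: "filterlim d at_top sequentially"
      then have upper: "(\<lambda>p. (1 + B) / d p) \<longlonglongrightarrow> 0"
        by (rule real_tendsto_divide_at_top[OF tendsto_const])
      show "(\<lambda>p. (1 + \<bar>c p\<bar>) / d p) \<longlonglongrightarrow> 0"
      proof (rule tendsto_sandwich[OF _ _ tendsto_const upper])
        show "\<forall>\<^sub>F p in sequentially. 0 \<le> (1 + \<bar>c p\<bar>) / d p"
          using ratio by eventually_elim simp
        show "\<forall>\<^sub>F p in sequentially. (1 + \<bar>c p\<bar>) / d p \<le> (1 + B) / d p"
          using ratio bound by eventually_elim (simp add: divide_right_mono)
      qed
    next
      assume lim: "(\<lambda>p. (1 + \<bar>c p\<bar>) / d p) \<longlonglongrightarrow> 0"
      have "(\<lambda>p. inverse (d p)) \<longlonglongrightarrow> 0"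
      proof (rule tendsto_sandwich[OF _ _ tendsto_const lim])
        show "\<forall>\<^sub>F p in sequentially. 0 \<le> inverse (d p)"
          using ratio by eventually_elim simp
        show "\<forall>\<^sub>F p in sequentially. inverse (d p) \<le> (1 + \<bar>c p\<bar>) / d p"
          using ratio by eventually_elim (simp add: divide_simps)
      qed
      then have "filterlim (\<lambda>p. inverse (inverse (d p))) at_top sequentially"
        by (rule filterlim_inverse_at_top) (use ratio in \<open>auto elim: eventually_mono\<close>)
      then show "filterlim d at_top sequentially" by simp
    qed
    also have "\<dots> \<longleftrightarrow> dominates \<delta> (delta_opt a b)"
      unfolding dominates_def
      by (rule tendsto_cong) (use ratio in \<open>auto elim: eventually_mono\<close>)
    finally show "(\<lambda>p. \<P>(\<omega> in M. \<bar>row_max \<epsilon> p \<omega> / a p - 1\<bar> > \<delta> p)) \<longlonglongrightarrow> 0 \<longleftrightarrow>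
        dominates \<delta> (delta_opt a b)"
      using main by simp
  next
    have excess: "\<forall>\<^sub>F p in sequentially.
      (\<delta> p / delta_opt a b p - 1) * (1 + a p * \<bar>b p - a p\<bar>) = - 1 + (d p - \<bar>c p\<bar>)"
      using pos abs_c
    proof eventually_elim
      case (elim p)
      then have opt: "(a p)\<^sup>2 * delta_opt a b p = 1 + \<bar>c p\<bar>"
        by (simp add: square_mult_delta_opt)
      then have "delta_opt a b p \<noteq> 0" by auto
      then have "(\<delta> p / delta_opt a b p - 1) * ((a p)\<^sup>2 * delta_opt a b p) =
          (a p)\<^sup>2 * \<delta> p - (a p)\<^sup>2 * delta_opt a b p"
        by (simp add: field_simps)
      with opt elim show ?case by (simp add: d_def)
    qed
    have "filterlim (\<lambda>p. d p - \<bar>c p\<bar>) at_top sequentially \<longleftrightarrow>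
        filterlim (\<lambda>p. - 1 + (d p - \<bar>c p\<bar>)) at_top sequentially"
      by (rule filterlim_tendsto_add_at_top_iff[OF tendsto_const, symmetric])
    also have "\<dots> \<longleftrightarrow> filterlim (\<lambda>p. (\<delta> p / delta_opt a b p - 1) * (1 + a p * \<bar>b p - a p\<bar>))
        at_top sequentially"
      by (rule filterlim_cong) (use excess in \<open>auto elim: eventually_mono\<close>)
    finally show "(\<lambda>p. \<P>(\<omega> in M. \<bar>row_max \<epsilon> p \<omega> / a p - 1\<bar> > \<delta> p)) \<longlonglongrightarrow> 0 \<longleftrightarrow>
        liminf (\<lambda>p. ereal ((\<delta> p / delta_opt a b p - 1) * (1 + a p * \<bar>b p - a p\<bar>))) = \<infinity>"
      using main by (simp add: liminf_ereal_eq_PInfty_iff)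
  qed
qed

end
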